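(* Let $a,b\ge 1$ be integers. There is an algorithm that, given a graph $G$ on $n$ vertices that contains no induced subgraph isomorphic to the complete bipartite graph $K_{a,b}$, computes in $n^{\mathcal{O}(a)}$ time an independent set of $G$ that is an $\mathcal{O}\bigl((a+b)^{1/a}\cdot \alpha(G)^{1-1/a}\bigr)$-approximation of a maximum independent set, i.e., an independent set $I$ with $|I|\cdot C\,(a+b)^{1/a}\alpha(G)^{1-1/a}\ge \alpha(G)$ for some absolute constant $C$.
   Context: $\alpha(G)$ denotes the maximum size of an independent set (a set of pairwise non-adjacent vertices) in $G$. A graph is $K_{a,b}$-free if it does not contain $K_{a,b}$ as an induced subgraph. *)

theory Defs
  imports Complex_Main "Graph_Theory.Graph_Theory"
begin

section \<open>Graphs\<close>

text \<open>
  Finite simple graphs are the symmetric loop-free digraphs of the library (locales \<open>graph\<close> and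
  \<open>pair_graph\<close>); \<open>K\<^bsub>a,b\<^esub> H\<close> is the library's predicate
  ``\<open>H\<close> is a complete bipartite graph with sides of sizes \<open>a\<close> and \<open>b\<close>''. It does not fix
  the vertex set, so no separate isomorphism is needed below.
\<close>

definition biclique_free :: "nat \<Rightarrow> nat \<Rightarrow> ('a, 'b) pre_digraph \<Rightarrow> bool" where
  "biclique_free a b G \<longleftrightarrow> \<not> (\<exists>H. induced_subgraph H G \<and> K\<^bsub>a,b\<^esub> H)"

definition independent_set :: "('a, 'b) pre_digraph \<Rightarrow> 'a set \<Rightarrow> bool" where
  "independent_set G I \<longleftrightarrow> I \<subseteq> verts G \<and> pairwise (\<lambda>u v. \<not> u \<rightarrow>\<^bsub>G\<^esub> v) I"

definition independence_number :: "('a, 'b) pre_digraph \<Rightarrow> nat" where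
  "independence_number G = Max (card ` {I. independent_set G I})"


section \<open>Machine model\<close>

text \<open>
  Algorithms are while-programs over a random access memory that is divided into finitely many
  named arrays of natural numbers; a scalar variable is an array used at index 0. The cost of a run
  is the number of commands executed plus the number of expression nodes evaluated. The only
  arithmetic operations are addition and truncated subtraction (there is no unit-cost
  multiplication), so the bit length of the stored numbers grows by at most one per step and cost
  is polynomially related to Turing machine time.
\<close>

type_synonym memory = "string \<Rightarrow> nat \<Rightarrow> nat"

datatype aexp = Lit nat | Read string aexp | Add aexp aexp | Sub aexp aexp

fun aval :: "aexp \<Rightarrow> memory \<Rightarrow> nat" where
  "aval (Lit k) m = k"
| "aval (Read x i) m = m x (aval i m)"
| "aval (Add e f) m = aval e m + aval f m"
| "aval (Sub e f) m = aval e m - aval f m"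

fun acost :: "aexp \<Rightarrow> nat" where
  "acost (Lit k) = 1"
| "acost (Read x i) = 1 + acost i"
| "acost (Add e f) = 1 + acost e + acost f"
| "acost (Sub e f) = 1 + acost e + acost f"

text \<open>Guards of \<open>Cond\<close> and \<open>Loop\<close> count as true iff their value is nonzero.\<close>

datatype com =
    Skip
  | Write string aexp aexp
  | Seq com com
  | Cond aexp com com
  | Loop aexp com

text \<open>\<open>runs P m t m'\<close>: started in memory \<open>m\<close>, \<open>P\<close> halts with cost \<open>t\<close> in memory \<open>m'\<close>.\<close>

inductive runs :: "com \<Rightarrow> memory \<Rightarrow> nat \<Rightarrow> memory \<Rightarrow> bool" where
  Skip: "runs Skip m 1 m"
| Write: "runs (Write x i e) m (1 + acost i + acost e) (m(x := (m x)(aval i m := aval e m)))"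
| Seq: "runs P m t m' \<Longrightarrow> runs Q m' t' m'' \<Longrightarrow> runs (Seq P Q) m (t + t') m''"
| CondTrue: "aval e m \<noteq> 0 \<Longrightarrow> runs P m t m' \<Longrightarrow> runs (Cond e P Q) m (1 + acost e + t) m'"
| CondFalse: "aval e m = 0 \<Longrightarrow> runs Q m t m' \<Longrightarrow> runs (Cond e P Q) m (1 + acost e + t) m'"
| LoopFalse: "aval e m = 0 \<Longrightarrow> runs (Loop e P) m (1 + acost e) m"
| LoopTrue: "aval e m \<noteq> 0 \<Longrightarrow> runs P m t m' \<Longrightarrow> runs (Loop e P) m' t' m'' \<Longrightarrow>
    runs (Loop e P) m (1 + acost e + t + t') m''"

inductive_cases SkipE: "runs Skip m t m'"
inductive_cases WriteE: "runs (Write x i e) m t m'"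
inductive_cases SeqE: "runs (Seq P Q) m t m'"
inductive_cases CondE: "runs (Cond e P Q) m t m'"
inductive_cases LoopE: "runs (Loop e P) m t m'"

lemma runs_deterministic:
  assumes "runs P m t m'" "runs P m u m''"
  shows "t = u \<and> m' = m''"
  using assms
proof (induction arbitrary: u m'' rule: runs.induct)
  case (Seq P m t m' Q t' m1)
  from Seq.prems obtain v w x where "u = v + w" "runs P m v x" "runs Q x w m''"
    by (rule SeqE)
  with Seq.IH(1)[of v x] Seq.IH(2)[of w m''] show ?case by simp
next
  case (CondTrue e m P t m' Q)
  from CondTrue.prems CondTrue.hyps(1) obtain v where "u = 1 + acost e + v" "runs P m v m''"
    by (auto elim: CondE)
  with CondTrue.IH[of v m''] show ?case by simp
next
  case (CondFalse e m Q t m' P)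
  from CondFalse.prems CondFalse.hyps(1) obtain v where "u = 1 + acost e + v" "runs Q m v m''"
    by (auto elim: CondE)
  with CondFalse.IH[of v m''] show ?case by simp
next
  case (LoopTrue e m P t m' t' m1)
  from LoopTrue.prems obtain v w x where
    "u = 1 + acost e + v + w" "runs P m v x" "runs (Loop e P) x w m''"
    by (rule LoopE) (use LoopTrue.hyps(1) in auto)
  with LoopTrue.IH(1)[of v x] LoopTrue.IH(2)[of w m''] show ?case by simp
next
  case LoopFalse
  from LoopFalse.prems show ?case by (rule LoopE) (use LoopFalse.hyps in simp_all)
qed (auto elim: SkipE WriteE)


section \<open>Input and output conventions\<close>

text \<open>
  A graph on \<open>n\<close> vertices is presented with vertex set \<open>{..<n}\<close>: \<open>n\<close> is stored in \<open>''n''\<close> and the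
  adjacency matrix in row-major order in \<open>''adj''\<close>. All other cells are initially 0. The computed
  vertex set is read off its characteristic vector, in the first \<open>n\<close> cells of \<open>''out''\<close>.
\<close>

definition graph_input :: "nat \<Rightarrow> nat pair_pre_digraph \<Rightarrow> memory" where
  "graph_input n G = (\<lambda>_ _. 0)
    (''n'' := (\<lambda>_. 0)(0 := n),
     ''adj'' := (\<lambda>k. if k < n * n \<and> (k div n, k mod n) \<in> parcs G then 1 else 0))"

definition output_set :: "nat \<Rightarrow> memory \<Rightarrow> nat set" where
  "output_set n m = {v. v < n \<and> m ''out'' v \<noteq> 0}"

end

theory Submission
  imports Defs
begin

text \<open>
  The algorithm is a local search. A move adds \<open>a\<close> vertices to the current independent set one
  after the other, each time discarding the neighbours of the new vertex, so that the set stays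
  independent throughout; the result is kept if it is larger. Suppose that no move enlarges \<open>I\<close>, and
  let \<open>J\<close> be independent. A set of at most \<open>a\<close> vertices of \<open>J - I\<close> then has at least as many
  neighbours in \<open>I\<close> as it has elements. So fewer than \<open>a\<close> vertices of \<open>J - I\<close> have all their
  \<open>I\<close>-neighbours in a given set of size \<open>a - 1\<close>, and, as the graph is \<open>K\<^bsub>a,b\<^esub>\<close>-free, fewer than
  \<open>b\<close> are adjacent to all of a given set of size \<open>a\<close>. Hence \<open>|J| \<le> (a + b) |I|\<^sup>a\<close>, which is the
  claimed ratio with \<open>C = 1\<close>.
\<close>

section \<open>Local optima in biclique-free graphs\<close>

definition absorb :: "('v \<times> 'v) set \<Rightarrow> 'v set \<Rightarrow> 'v \<Rightarrow> 'v set" where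
  "absorb E X u = insert u (X - E `` {u})"

lemma finite_foldl_absorb: "finite X \<Longrightarrow> finite (foldl (absorb E) X us)"
  by (induction us arbitrary: X) (auto simp: absorb_def)

text \<open>A move lists exactly \<open>a\<close> vertices, while the exchange argument concerns
  sets of at most \<open>a\<close>. The gap is closed by repeating one element, hence the nonempty
  \<open>U\<close>.\<close>

lemma ex_list_of_length:
  assumes "finite U" "U \<noteq> {}" "card U \<le> l"
  shows "\<exists>us. length us = l \<and> set us = U"
proof -
  obtain xs where xs: "set xs = U" "distinct xs"
    using finite_distinct_list[OF assms(1)] by blast
  obtain u where "u \<in> U" using assms(2) by blast
  with xs assms(3) have "length (xs @ replicate (l - card U) u) = l"
    "set (xs @ replicate (l - card U) u) = U"
    by (auto simp: distinct_card[symmetric])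
  then show ?thesis by blast
qed

context pair_graph
begin

lemma parcs_sym: "(u, v) \<in> parcs G \<Longrightarrow> (v, u) \<in> parcs G"
  using pair_sym_arcs by (auto simp: symmetric_def dest: symD)

lemma independent_set_pair_iff:
  "independent_set G I \<longleftrightarrow> I \<subseteq> pverts G \<and> (\<forall>u\<in>I. \<forall>v\<in>I. (u, v) \<notin> parcs G)"
  using pair_no_loops by (fastforce simp: independent_set_def pairwise_def)

lemma independent_set_subset: "independent_set G I \<Longrightarrow> I' \<subseteq> I \<Longrightarrow> independent_set G I'"
  unfolding independent_set_def pairwise_def by blast

lemma independent_set_absorb:
  assumes "independent_set G X" "u \<in> pverts G"
  shows "independent_set G (absorb (parcs G) X u)"
  using assms parcs_sym pair_no_loops
  unfolding independent_set_pair_iff absorb_def by fastforce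

lemma independent_set_finite: "independent_set G X \<Longrightarrow> finite X"
  using finite_subset[OF _ pair_finite_verts] by (auto simp: independent_set_def)

text \<open>A vertex of \<open>X\<close> is lost only to a neighbour in the list, and pairwise
  non-adjacency keeps later entries from discarding earlier ones.\<close>

lemma subset_foldl_absorb:
  assumes "\<forall>u\<in>set us. \<forall>v\<in>set us. (u, v) \<notin> parcs G"
  shows "(X - parcs G `` set us) \<union> set us \<subseteq> foldl (absorb (parcs G)) X us"
  using assms
proof (induction us rule: rev_induct)
  case (snoc u us)
  then have "(X - parcs G `` set us) \<union> set us \<subseteq> foldl (absorb (parcs G)) X us" by simp
  moreover have "(u, v) \<notin> parcs G" if "v \<in> set us" for v
    using snoc.prems that by simp
  ultimately show ?case by (auto simp: absorb_def[of _ "foldl _ _ _"])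
qed simp

text \<open>Balance of a move: new vertices gained against old neighbours lost, in additive form to
  avoid truncated subtraction. Repeated entries count once.\<close>

lemma card_foldl_absorb:
  assumes "finite X" "set us \<inter> X = {}" "\<forall>u\<in>set us. \<forall>v\<in>set us. (u, v) \<notin> parcs G"
  shows "card X + card (set us) \<le> card (foldl (absorb (parcs G)) X us) + card (X \<inter> parcs G `` set us)"
proof -
  let ?N = "parcs G `` set us"
  have "card X = card (X - ?N) + card (X \<inter> ?N)"
    using assms(1) by (metis add.commute card_Int_Diff)
  moreover have "card ((X - ?N) \<union> set us) = card (X - ?N) + card (set us)"
    using assms by (intro card_Un_disjoint) auto
  moreover have "card ((X - ?N) \<union> set us) \<le> card (foldl (absorb (parcs G)) X us)"
    using assms by (intro card_mono subset_foldl_absorb finite_foldl_absorb)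
  ultimately show ?thesis by linarith
qed

text \<open>Otherwise \<open>A\<close> and \<open>b\<close> vertices of \<open>B\<close> span a
  complete bipartite graph, which is induced because both sides are independent.\<close>

lemma biclique_free_card:
  assumes bf: "biclique_free a b G" and A: "independent_set G A" "card A = a"
    and B: "independent_set G B" and dis: "A \<inter> B = {}" and adj: "A \<times> B \<subseteq> parcs G"
  shows "card B < b"
proof (rule ccontr)
  assume "\<not> card B < b"
  then obtain B' where B': "B' \<subseteq> B" "card B' = b"
    by (metis not_less obtain_subset_with_card_n)
  let ?H = "\<lparr>pverts = A \<union> B', parcs = A \<times> B' \<union> B' \<times> A\<rparr>"
  have fin: "finite (A \<union> B')"
    using A B B' by (meson finite_UnI finite_subset independent_set_finite)
  have B'_ind: "independent_set G B'" using independent_set_subset B B' by blast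
  have "wf_digraph (with_proj ?H)" by unfold_locales auto
  then have "induced_subgraph (with_proj ?H) G"
    using A B' B'_ind adj parcs_sym wf_digraph
    by (auto simp: induced_subgraph_def subgraph_def compatible_def independent_set_pair_iff)
  moreover have "K\<^bsub>a,b\<^esub> (with_proj ?H)"
    unfolding complete_bipartite_digraph_pair_def
    using fin A B' dis by (intro conjI exI[of _ A] exI[of _ B']) auto
  ultimately show False using bf by (auto simp: biclique_free_def)
qed

text \<open>Every vertex of \<open>J - I\<close> is charged to a list over \<open>I\<close>: to
  \<open>a\<close> distinct neighbours if it has that many, else to a list of length
  \<open>a - 1\<close> made up of all its neighbours. Lists are counted rather than subsets because
  their number is an exact power of \<open>card I\<close>.\<close>

lemma card_independent_set_le_local_optimum:
  assumes bf: "biclique_free a b G" and a: "1 \<le> a"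
    and I: "independent_set G I" and J: "independent_set G J"
    and opt: "\<And>us. length us = a \<Longrightarrow> set us \<subseteq> pverts G \<Longrightarrow>
      card (foldl (absorb (parcs G)) I us) \<le> card I"
  shows "card J \<le> (a + b) * card I ^ a"
proof -
  define N where "N U = I \<inter> parcs G `` U" for U
  note fin = independent_set_finite[OF I] independent_set_finite[OF J]
  \<comment> \<open>A violating \<open>U\<close>, padded to length \<open>a\<close>, would be a move
    that enlarges \<open>I\<close>.\<close>
  have exchange: "card U \<le> card (N U)" if "U \<subseteq> J - I" "card U \<le> a" for U
  proof (cases "U = {}")
    case False
    have "finite U" using that fin by (meson finite_Diff finite_subset)
    then obtain us where us: "length us = a" "set us = U"
      using ex_list_of_length False \<open>card U \<le> a\<close> by metis
    have UJ: "U \<subseteq> pverts G" "\<forall>u\<in>U. \<forall>v\<in>U. (u, v) \<notin> parcs G"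
      using that J by (auto simp: independent_set_pair_iff)
    have "card I + card U \<le> card (foldl (absorb (parcs G)) I us) + card (N U)"
      using card_foldl_absorb[of I us] that fin us UJ unfolding N_def by auto
    then show ?thesis using opt[of us] us UJ by auto
  qed simp
  have N_mem: "N {v} \<subseteq> I" "finite (N {v})" for v
    using fin by (auto simp: N_def)
  define L where "L = {us. set us \<subseteq> I \<and> length us = a}"
  define S where "S = {us. set us \<subseteq> I \<and> length us = a - 1}"
  \<comment> \<open>Lists with repetitions get an empty class, as the biclique bound speaks of
    \<open>a\<close> distinct vertices.\<close>
  define D where "D us = (if distinct us then {v \<in> J - I. set us \<subseteq> N {v}} else {})" for us
  define W where "W us = {v \<in> J - I. N {v} \<subseteq> set us}" for us
  have cardL: "card L = card I ^ a" "finite L"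
    using fin card_lists_length_eq[of I a] finite_lists_length_eq[of I a] by (auto simp: L_def)
  have cardS: "card S = card I ^ (a - 1)" "finite S"
    using fin card_lists_length_eq[of I "a - 1"] finite_lists_length_eq[of I "a - 1"]
    by (auto simp: S_def)
  have D: "card (D us) \<le> b" if "us \<in> L" for us
  proof (cases "distinct us")
    case True
    have "card (D us) < b"
    proof (rule biclique_free_card[OF bf, of "set us"])
      show "independent_set G (set us)" "independent_set G (D us)"
        using that independent_set_subset[OF I] independent_set_subset[OF J]
        by (auto simp: L_def D_def)
      show "card (set us) = a" using True that distinct_card by (auto simp: L_def)
      show "set us \<inter> D us = {}" using that by (auto simp: L_def D_def)
      show "set us \<times> D us \<subseteq> parcs G" using parcs_sym by (auto simp: D_def N_def)
    qed
    then show ?thesis by simp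
  qed (simp add: D_def)
  \<comment> \<open>Any \<open>a\<close> vertices of the class would together have at most
    \<open>a - 1\<close> neighbours in \<open>I\<close>, against \<open>exchange\<close>.\<close>
  have W: "card (W us) \<le> a - 1" if "us \<in> S" for us
  proof (rule ccontr)
    assume "\<not> card (W us) \<le> a - 1"
    then have "a \<le> card (W us)" by simp
    then obtain U where U: "U \<subseteq> W us" "card U = a" by (rule obtain_subset_with_card_n)
    then have "a \<le> card (N U)" using exchange[of U] by (auto simp: W_def)
    also have "N U \<subseteq> set us" using U by (auto simp: W_def N_def)
    then have "card (N U) \<le> card (set us)" by (intro card_mono) auto
    also have "\<dots> \<le> a - 1" using that card_length[of us] by (auto simp: S_def)
    finally show False using a by simp
  qed
  have "J - I \<subseteq> (\<Union>us\<in>L. D us) \<union> (\<Union>us\<in>S. W us)"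
  proof
    fix v assume v: "v \<in> J - I"
    show "v \<in> (\<Union>us\<in>L. D us) \<union> (\<Union>us\<in>S. W us)"
    proof (cases "a \<le> card (N {v})")
      case True
      then obtain A where A: "A \<subseteq> N {v}" "card A = a" "finite A"
        by (rule obtain_subset_with_card_n)
      then obtain us where "set us = A" "distinct us" using finite_distinct_list by blast
      then have "us \<in> L" "v \<in> D us"
        using A v N_mem distinct_card[of us] by (auto simp: L_def D_def)
      then show ?thesis by blast
    next
      case False
      \<comment> \<open>This supplies an element with which to pad the list to length
        \<open>a - 1\<close>.\<close>
      moreover have "N {v} \<noteq> {}"
        using exchange[of "{v}"] v a by auto
      ultimately obtain us where "length us = a - 1" "set us = N {v}"
        using ex_list_of_length[of "N {v}" "a - 1"] N_mem by force
      then have "us \<in> S" "v \<in> W us" using v N_mem by (auto simp: S_def W_def)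
      then show ?thesis by blast
    qed
  qed
  moreover have finU: "finite ((\<Union>us\<in>L. D us) \<union> (\<Union>us\<in>S. W us))"
    using cardL cardS fin by (auto simp: D_def W_def)
  ultimately have "card (J - I) \<le> card ((\<Union>us\<in>L. D us) \<union> (\<Union>us\<in>S. W us))"
    by (intro card_mono)
  also have "\<dots> \<le> card (\<Union>us\<in>L. D us) + card (\<Union>us\<in>S. W us)" by (rule card_Un_le)
  also have "\<dots> \<le> (\<Sum>us\<in>L. card (D us)) + (\<Sum>us\<in>S. card (W us))"
    using cardL cardS by (intro add_mono card_UN_le)
  also have "\<dots> \<le> card L * b + card S * (a - 1)"
    using D W sum_bounded_above[of L "\<lambda>us. card (D us)" b]
      sum_bounded_above[of S "\<lambda>us. card (W us)" "a - 1"] by (intro add_mono) auto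
  finally have JI: "card (J - I) \<le> card I ^ a * b + card I ^ (a - 1) * (a - 1)"
    using cardL cardS by simp
  show ?thesis
  proof (cases "J = {}")
    case False
    have "I \<noteq> {}"
    proof
      assume "I = {}"
      with False obtain v where "v \<in> J - I" by blast
      then show False using exchange[of "{v}"] \<open>I = {}\<close> a by (auto simp: N_def)
    qed
    then have k: "1 \<le> card I" using fin by (simp add: Suc_leI card_gt_0_iff)
    have "card J \<le> card I + card (J - I)"
      using card_Int_Diff[of J I] card_mono[of I "J \<inter> I"] fin by simp
    \<comment> \<open>As \<open>card I\<close> is positive, all terms can be raised to the power
      \<open>a\<close>; the coefficients 1, \<open>b\<close> and \<open>a - 1\<close> add up to
      \<open>a + b\<close>.\<close>
    also have "\<dots> \<le> card I ^ a + (card I ^ a * b + card I ^ a * (a - 1))"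
      using k a power_increasing[of 1 a "card I"] power_increasing[of "a - 1" a "card I"]
      by (intro add_mono order_trans[OF JI]) (auto simp: mult_le_mono1)
    also have "\<dots> = (a + b) * card I ^ a"
      using a by (cases a) (simp_all add: algebra_simps)
    finally show ?thesis .
  qed simp
qed

end

section \<open>From the counting bound to the approximation ratio\<close>

text \<open>Take \<open>a\<close>-th roots in the hypothesis and multiply by the complementary power
  of \<open>\<alpha>\<close>.\<close>

lemma powr_approximation:
  fixes k \<alpha> a b :: nat
  assumes "1 \<le> a" "\<alpha> \<le> (a + b) * k ^ a"
  shows "real \<alpha> \<le> real k * (real (a + b) powr (1 / real a) * real \<alpha> powr (1 - 1 / real a))"
proof (cases "\<alpha> = 0")
  case False
  with assms have "k \<noteq> 0" by (cases "k = 0") (auto simp: zero_power)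
  have split: "real \<alpha> = real \<alpha> powr (1 / a) * real \<alpha> powr (1 - 1 / a)"
    using False by (simp flip: powr_add)
  have "real \<alpha> powr (1 / a) \<le> (real (a + b) * real k ^ a) powr (1 / a)"
    using assms(2) by (intro powr_mono2) (simp_all flip: of_nat_power of_nat_mult of_nat_add)
  also have "\<dots> = real (a + b) powr (1 / a) * real k"
    using assms \<open>k \<noteq> 0\<close> by (simp add: powr_mult powr_powr flip: powr_realpow)
  finally have "real \<alpha> powr (1 / a) \<le> real k * real (a + b) powr (1 / a)"
    by (simp add: mult.commute)
  then have "real \<alpha> powr (1 / a) * real \<alpha> powr (1 - 1 / a)
      \<le> real k * real (a + b) powr (1 / a) * real \<alpha> powr (1 - 1 / a)"
    by (rule mult_right_mono) simp
  with split show ?thesis by (simp only: mult.assoc)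
qed simp


section \<open>While-programs with time bounds\<close>

text \<open>A syntactic upper bound on what a run can change, by whole arrays rather than
  cells.\<close>

fun writes :: "com \<Rightarrow> string set" where
  "writes Skip = {}"
| "writes (Write x i e) = {x}"
| "writes (Seq P Q) = writes P \<union> writes Q"
| "writes (Cond e P Q) = writes P \<union> writes Q"
| "writes (Loop e P) = writes P"

lemma runs_frame: "runs P m t m' \<Longrightarrow> x \<notin> writes P \<Longrightarrow> m' x = m x"
  by (induction rule: runs.induct) auto

definition halts :: "com \<Rightarrow> memory \<Rightarrow> nat \<Rightarrow> (memory \<Rightarrow> bool) \<Rightarrow> bool" where
  "halts P m T Q \<longleftrightarrow> (\<exists>t m'. runs P m t m' \<and> t \<le> T \<and> Q m')"

text \<open>Consequence and frame rule in one: unwritten arrays are known to be unchanged when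
  \<open>Q\<close> is proved, so specifications need not say so.\<close>

lemma halts_conseq:
  assumes "halts P m T R" "T \<le> T'"
    and "\<And>m'. R m' \<Longrightarrow> (\<And>x. x \<notin> writes P \<Longrightarrow> m' x = m x) \<Longrightarrow> Q m'"
  shows "halts P m T' Q"
  using assms runs_frame unfolding halts_def by (meson order_trans)

lemma halts_Skip: "Q m \<Longrightarrow> 1 \<le> T \<Longrightarrow> halts Skip m T Q"
  unfolding halts_def using runs.Skip by blast

lemma halts_Write:
  "Q (m(x := (m x)(aval i m := aval e m))) \<Longrightarrow> 1 + acost i + acost e \<le> T \<Longrightarrow>
    halts (Write x i e) m T Q"
  unfolding halts_def using runs.Write by blast

text \<open>In the style of weakest preconditions, the specification of \<open>Q\<close> serves as
  postcondition of \<open>P\<close>.\<close>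

lemma halts_Seq:
  "halts P m T (\<lambda>m'. halts Q m' T' R) \<Longrightarrow> T + T' \<le> T'' \<Longrightarrow> halts (Seq P Q) m T'' R"
  unfolding halts_def by (meson add_mono order_trans runs.Seq)

lemma halts_Cond:
  assumes "aval e m \<noteq> 0 \<Longrightarrow> halts P m T R" "aval e m = 0 \<Longrightarrow> halts Q m T R"
    and "1 + acost e + T \<le> T'"
  shows "halts (Cond e P Q) m T' R"
proof (cases "aval e m = 0")
  case True
  then obtain t m' where "runs Q m t m'" "t \<le> T" "R m'" using assms by (auto simp: halts_def)
  then show ?thesis
    using runs.CondFalse[OF True] assms(3) unfolding halts_def by fastforce
next
  case False
  then obtain t m' where "runs P m t m'" "t \<le> T" "R m'" using assms by (auto simp: halts_def)
  then show ?thesis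
    using runs.CondTrue[OF False] assms(3) unfolding halts_def by fastforce
qed

abbreviation Var :: "string \<Rightarrow> aexp" where "Var x \<equiv> Read x (Lit 0)"

text \<open>The truncated difference in the guard is nonzero exactly while the counter is below the
  value in \<open>''n''\<close>.\<close>

definition For :: "string \<Rightarrow> com \<Rightarrow> com" where
  "For x P = Seq (Write x (Lit 0) (Lit 0))
    (Loop (Sub (Var ''n'') (Var x)) (Seq P (Write x (Lit 0) (Add (Var x) (Lit 1)))))"

lemma writes_For [simp]: "writes (For x P) = insert x (writes P)"
  by (auto simp: For_def)

text \<open>\<open>J i\<close> is the invariant after \<open>i\<close> rounds and must not depend on
  the counter array, which the loop overwrites. The 9 is initialisation (3) plus the last guard (6);
  the 12 is guard (6) plus increment (6) in each round.\<close>

lemma halts_For: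
  assumes n: "m ''n'' 0 = n" "x \<noteq> ''n''" "''n'' \<notin> writes P"
    and x: "x \<notin> writes P" "\<And>i m f. J i m \<Longrightarrow> J i (m(x := f))"
    and init: "J 0 m"
    and step: "\<And>i m'. i < n \<Longrightarrow> J i m' \<Longrightarrow> m' x 0 = i \<Longrightarrow>
      (\<And>y. y \<noteq> x \<Longrightarrow> y \<notin> writes P \<Longrightarrow> m' y = m y) \<Longrightarrow> halts P m' T (J (Suc i))"
    and T': "9 + n * (T + 12) \<le> T'"
  shows "halts (For x P) m T' (J n)"
proof -
  let ?incr = "Write x (Lit 0) (Add (Var x) (Lit 1))"
  let ?loop = "Loop (Sub (Var ''n'') (Var x)) (Seq P ?incr)"
  \<comment> \<open>By induction on \<open>d\<close>, the number of rounds still to come.\<close>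
  have loop: "halts ?loop m' (6 + d * (T + 12)) (J n)"
    if "i + d = n" "m' x 0 = i" "J i m'" "\<And>y. y \<noteq> x \<Longrightarrow> y \<notin> writes P \<Longrightarrow> m' y = m y" for d i m'
    using that
  proof (induction d arbitrary: i m')
    case 0
    moreover have "m' ''n'' = m ''n''" using 0(4) n by metis
    ultimately have "runs ?loop m' 6 m'"
      using runs.LoopFalse[of "Sub (Var ''n'') (Var x)" m' "Seq P ?incr"] n
      by (simp add: eval_nat_numeral)
    then show ?case using 0 by (auto simp: halts_def)
  next
    case (Suc d)
    have mn: "m' ''n'' = m ''n''" using Suc.prems(4) n by metis
    obtain t m1 where P: "runs P m' t m1" "t \<le> T" "J (Suc i) m1"
      using step[of i m'] Suc.prems unfolding halts_def by force
    let ?m2 = "m1(x := (m1 x)(0 := Suc i))"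
    have m1: "y \<notin> writes P \<Longrightarrow> m1 y = m' y" for y using runs_frame P(1) by blast
    have "runs ?incr m1 6 ?m2"
      using runs.Write[of x "Lit 0" "Add (Var x) (Lit 1)" m1] m1[of x] x Suc.prems(2)
      by (simp add: eval_nat_numeral)
    with P(1) have body: "runs (Seq P ?incr) m' (t + 6) ?m2" by (rule runs.Seq)
    have "halts ?loop ?m2 (6 + d * (T + 12)) (J n)"
    proof (rule Suc.IH)
      show "J (Suc i) ?m2" using x(2) P(3) .
      show "?m2 y = m y" if "y \<noteq> x" "y \<notin> writes P" for y using that m1 Suc.prems(4) by simp
    qed (use Suc.prems in auto)
    then obtain t' m3 where "runs ?loop ?m2 t' m3" "t' \<le> 6 + d * (T + 12)" "J n m3"
      by (auto simp: halts_def)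
    moreover have "aval (Sub (Var ''n'') (Var x)) m' \<noteq> 0"
      using mn n Suc.prems by simp
    ultimately show ?case
      using runs.LoopTrue[OF _ body] P(2) unfolding halts_def by fastforce
  qed
  have "halts ?loop (m(x := (m x)(0 := 0))) (6 + n * (T + 12)) (J n)"
    by (rule loop[of 0]) (use init x in auto)
  then show ?thesis
    unfolding For_def using T' 
    by (intro halts_Seq[where T = 3 and T' = "6 + n * (T + 12)"] halts_Write) auto
qed

section \<open>The local search program\<close>

text \<open>
  Each recursion level uses its own arrays. The name of such an array is a letter for its role
  followed by one \<open>x\<close> per level.
\<close>

definition level :: "char \<Rightarrow> nat \<Rightarrow> string" where
  "level ch k = ch # replicate k CHR ''x''"

lemma level_eq_Cons [simp]:
  "level ch k = c # cs \<longleftrightarrow> ch = c \<and> replicate k CHR ''x'' = cs"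
  "c # cs = level ch k \<longleftrightarrow> ch = c \<and> replicate k CHR ''x'' = cs"
  by (auto simp: level_def)

lemma level_eq_iff [simp]: "level ch k = level ch' k' \<longleftrightarrow> ch = ch' \<and> k = k'"
  by (simp add: level_def)

text \<open>Levels count down: absorbing the vertex in \<open>ctr k\<close> turns the set in
  \<open>cand (Suc k)\<close> into the one in \<open>cand k\<close>. The start of that vertex's
  matrix row is kept in \<open>row k\<close>, since the machine cannot multiply.\<close>

abbreviation cand :: "nat \<Rightarrow> string" where "cand \<equiv> level CHR ''s''"
abbreviation ctr :: "nat \<Rightarrow> string" where "ctr \<equiv> level CHR ''c''"
abbreviation row :: "nat \<Rightarrow> string" where "row \<equiv> level CHR ''r''"

definition copy_com :: "string \<Rightarrow> string \<Rightarrow> com" where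
  "copy_com y z = For ''v'' (Write y (Var ''v'') (Read z (Var ''v'')))"

definition absorb_com :: "nat \<Rightarrow> com" where
  "absorb_com k = Seq
    (For ''v'' (Cond (Read ''adj'' (Add (Var (row k)) (Var ''v'')))
      (Write (cand k) (Var ''v'') (Lit 0))
      (Write (cand k) (Var ''v'') (Read (cand (Suc k)) (Var ''v'')))))
    (Write (cand k) (Var (ctr k)) (Lit 1))"

definition sizes_com :: com where
  "sizes_com = Seq (Write ''d'' (Lit 0) (Lit 0)) (Seq (Write ''e'' (Lit 0) (Lit 0)) (For ''v'' (Seq
    (Write ''d'' (Lit 0) (Add (Var ''d'') (Read (cand 0) (Var ''v''))))
    (Write ''e'' (Lit 0) (Add (Var ''e'') (Read ''out'' (Var ''v'')))))))"

text \<open>The level is the number of vertices still to be added, so the nested loops run through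
  all lists of that length. At level 0 the result is compared with the best set so far, in
  \<open>''out''\<close>.\<close>

fun search_com :: "nat \<Rightarrow> com" where
  "search_com 0 = Seq sizes_com
    (Cond (Sub (Var ''d'') (Var ''e'')) (copy_com ''out'' (cand 0)) Skip)"
| "search_com (Suc k) = Seq (Write (row k) (Lit 0) (Lit 0)) (For (ctr k)
    (Seq (absorb_com k) (Seq (search_com k)
      (Write (row k) (Lit 0) (Add (Var (row k)) (Var ''n''))))))"

text \<open>A pass starts from a copy, as \<open>''out''\<close> may be overwritten while moves from
  the old set are still being tried.\<close>

definition local_search_com :: "nat \<Rightarrow> com" where
  "local_search_com a = For ''p'' (Seq (copy_com (cand a) ''out'') (search_com a))"

lemma writes_copy_com [simp]: "writes (copy_com y z) = {''v'', y}"
  by (auto simp: copy_com_def)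

lemma writes_absorb_com [simp]: "writes (absorb_com k) = {''v'', cand k}"
  by (auto simp: absorb_com_def)

lemma writes_sizes_com [simp]: "writes sizes_com = {''v'', ''d'', ''e''}"
  by (auto simp: sizes_com_def)

text \<open>The bound \<open>j < k\<close> is strict: the starting set in \<open>cand k\<close>
  survives the search.\<close>

lemma writes_search_com:
  "writes (search_com k) =
    {''v'', ''d'', ''e'', ''out''} \<union> {x. \<exists>j<k. x = cand j \<or> x = ctr j \<or> x = row j}"
  by (induction k) (auto simp: less_Suc_eq)

section \<open>Running time\<close>

text \<open>At level 0 this is \<open>15 + 28 * n\<close> for counting plus
  \<open>15 + 18 * n\<close> for the conditional copy. Higher up, 12 is the reset of
  \<open>row k\<close> plus loop overhead, and 32 is 13 (absorbing), 7 (advancing the row) and 12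
  (loop control).\<close>

fun search_time :: "nat \<Rightarrow> nat \<Rightarrow> nat" where
  "search_time n 0 = 30 + 46 * n"
| "search_time n (Suc k) = 12 + n * (32 + 25 * n + search_time n k)"

definition local_search_time :: "nat \<Rightarrow> nat \<Rightarrow> nat" where
  "local_search_time n a = 9 + n * (21 + 18 * n + search_time n a)"

lemma search_time_le:
  assumes "n \<le> N" "2 \<le> N"
  shows "search_time n k \<le> N ^ (10 + 8 * k)"
proof (induction k)
  case 0
  have "30 + 46 * n \<le> 2 ^ 5 + 2 ^ 6 * N" using assms by simp
  also have "\<dots> \<le> N ^ 5 + N ^ 6 * N" using assms by (intro add_mono mult_mono power_mono) auto
  also have "\<dots> \<le> N ^ 7 + N ^ 7"
    using assms power_increasing[of 5 7 N] by (simp flip: power_Suc2)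
  also have "\<dots> \<le> N * N ^ 7" using assms by (simp flip: mult_2)
  also have "\<dots> \<le> N ^ 10" using assms power_increasing[of 8 10 N] by (simp flip: power_Suc)
  finally show ?case by simp
next
  case (Suc k)
  define M where "M = N ^ (10 + 8 * k)"
  have M: "N ^ j \<le> M" if "j \<le> 10" for j
    unfolding M_def using assms that by (intro power_increasing) auto
  have "12 + n * (32 + 25 * n + search_time n k) \<le> 2 ^ 4 + N * (2 ^ 5 + 2 ^ 5 * N + M)"
    using assms Suc by (intro add_mono mult_mono) (auto simp: M_def)
  \<comment> \<open>\<open>M\<close> dominates \<open>N ^ 10\<close>, so a level costs a factor of
    at most \<open>N ^ 3\<close>, within the \<open>N ^ 8\<close> allowed.\<close>
  also have "\<dots> \<le> N ^ 4 + N * (N ^ 5 + N ^ 5 * N + M)"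
    using assms by (intro add_mono mult_mono power_mono) auto
  also have "\<dots> = N ^ 4 + N ^ 6 + N ^ 7 + N * M"
    by (simp add: algebra_simps eval_nat_numeral)
  also have "\<dots> \<le> M + M + M + N * M"
    using M[of 4] M[of 6] M[of 7] by simp
  also have "\<dots> \<le> N * N * N * M"
  proof -
    have "3 + N \<le> 4 * N" "2 * 2 \<le> N * N" using assms mult_le_mono[of 2 N 2 N] by simp_all
    then have "3 + N \<le> N * N * N" using mult_le_mono1[of "2 * 2" "N * N" N] by linarith
    then have "(3 + N) * M \<le> N * N * N * M" by (rule mult_le_mono1)
    then show ?thesis by (simp add: algebra_simps)
  qed
  also have "\<dots> = N ^ (13 + 8 * k)" by (simp add: M_def power_add eval_nat_numeral)
  also have "\<dots> \<le> N ^ (10 + 8 * Suc k)" using assms by (intro power_increasing) auto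
  finally show ?case by simp
qed

text \<open>The outer loop costs no more than one further level of the search; the exponent
  \<open>10 + 8 * Suc a\<close> is at most \<open>26 * a\<close> because \<open>a\<close> is
  positive.\<close>

lemma local_search_time_le:
  assumes "1 \<le> a"
  shows "local_search_time n a \<le> max 2 n ^ (26 * a)"
proof -
  have "local_search_time n a \<le> search_time n (Suc a)" 
    unfolding local_search_time_def search_time.simps by (intro add_mono mult_mono) auto
  also have "\<dots> \<le> max 2 n ^ (10 + 8 * Suc a)" by (intro search_time_le) auto
  also have "\<dots> \<le> max 2 n ^ (26 * a)" using assms by (intro power_increasing) auto
  finally show ?thesis .
qed

section \<open>Correctness of the subroutines\<close>

lemma halts_copy_com:
  assumes "m ''n'' 0 = n" "y \<notin> {''v'', ''n'', z}" "z \<noteq> ''v''"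
  shows "halts (copy_com y z) m (9 + 18 * n) (\<lambda>m'. \<forall>v<n. m' y v = m z v)"
  unfolding copy_com_def
proof (rule halts_For[where T = 6 and J = "\<lambda>i m'. \<forall>v<i. m' y v = m z v" and n = n])
  fix i m' assume "\<forall>v<i. m' y v = m z v" "m' ''v'' 0 = i"
    "\<And>w. w \<noteq> ''v'' \<Longrightarrow> w \<notin> writes (Write y (Var ''v'') (Read z (Var ''v''))) \<Longrightarrow> m' w = m w"
  then show "halts (Write y (Var ''v'') (Read z (Var ''v''))) m' 6 (\<lambda>m'. \<forall>v<Suc i. m' y v = m z v)"
    using assms by (intro halts_Write) (auto simp: less_Suc_eq)
qed (use assms in auto)

text \<open>Entries are exactly 0 or 1, so that summing them gives the cardinality.\<close>

definition encodes :: "nat \<Rightarrow> nat set \<Rightarrow> (nat \<Rightarrow> nat) \<Rightarrow> bool" where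
  "encodes n X f \<longleftrightarrow> (\<forall>v<n. f v = of_bool (v \<in> X))"

lemma halts_sizes_com:
  assumes n: "m ''n'' 0 = n" and X: "encodes n X (m (cand 0))" "X \<subseteq> {..<n}"
    and Y: "encodes n Y (m ''out'')" "Y \<subseteq> {..<n}"
  shows "halts sizes_com m (15 + 28 * n) (\<lambda>m'. m' ''d'' 0 = card X \<and> m' ''e'' 0 = card Y)"
proof -
  let ?P = "Seq (Write ''d'' (Lit 0) (Add (Var ''d'') (Read (cand 0) (Var ''v''))))
    (Write ''e'' (Lit 0) (Add (Var ''e'') (Read ''out'' (Var ''v''))))"
  let ?J = "\<lambda>i m'. m' ''d'' 0 = card (X \<inter> {..<i}) \<and> m' ''e'' 0 = card (Y \<inter> {..<i})"
  let ?m = "m(''d'' := (m ''d'')(0 := 0), ''e'' := (m ''e'')(0 := 0))"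
  have card_Suc: "card (Z \<inter> {..<Suc i}) = card (Z \<inter> {..<i}) + of_bool (i \<in> Z)"
    for Z :: "nat set" and i
    by (simp add: lessThan_Suc Int_insert_right)
  have "halts (For ''v'' ?P) ?m (9 + 28 * n) (?J n)"
  proof (rule halts_For[where T = 16 and J = ?J and n = n])
    fix i m' assume i: "i < n" "?J i m'" "m' ''v'' 0 = i"
      "\<And>y. y \<noteq> ''v'' \<Longrightarrow> y \<notin> writes ?P \<Longrightarrow> m' y = ?m y"
    have "m' (cand 0) = m (cand 0)" "m' ''out'' = m ''out''"
      using i(4)[of "cand 0"] i(4)[of "''out''"] by auto
    then show "halts ?P m' 16 (?J (Suc i))"
      using i(1-3) X Y
      by (intro halts_Seq[where T = 8 and T' = 8] halts_Write) (simp_all add: card_Suc encodes_def)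
  qed (use n in auto)
  moreover have "X \<inter> {..<n} = X" "Y \<inter> {..<n} = Y" using X Y by auto
  ultimately show ?thesis
    unfolding sizes_com_def
    by (intro halts_Seq[where T = 3 and T' = "12 + 28 * n"]
        halts_Seq[where T = 3 and T' = "9 + 28 * n"] halts_Write) simp_all
qed

locale numbered_graph = pair_graph G for G :: "nat pair_pre_digraph" +
  fixes n :: nat
  assumes pverts: "pverts G = {..<n}"
begin

definition stores_graph :: "memory \<Rightarrow> bool" where
  "stores_graph m \<longleftrightarrow> m ''n'' 0 = n \<and>
    (\<forall>u<n. \<forall>v<n. m ''adj'' (u * n + v) = of_bool ((u, v) \<in> parcs G))"

lemma stores_graph_cong:
  "stores_graph m \<Longrightarrow> m' ''n'' = m ''n'' \<Longrightarrow> m' ''adj'' = m ''adj'' \<Longrightarrow> stores_graph m'"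
  by (simp add: stores_graph_def)

lemma stores_graph_input: "stores_graph (graph_input n G)"
proof -
  have "u * n + v < n * n" if "u < n" "v < n" for u v
  proof -
    have "u * n + v < Suc u * n" using that by simp
    also have "\<dots> \<le> n * n" using that by (intro mult_le_mono1) simp
    finally show ?thesis .
  qed
  then show ?thesis by (auto simp: stores_graph_def graph_input_def)
qed

lemma independent_set_less: "independent_set G X \<Longrightarrow> X \<subseteq> {..<n}"
  by (simp add: independent_set_def pverts)

lemma halts_absorb_com:
  assumes G: "stores_graph m" and u: "u < n" "m (ctr k) 0 = u" "m (row k) 0 = u * n"
    and X: "encodes n X (m (cand (Suc k)))"
  shows "halts (absorb_com k) m (13 + 25 * n) (\<lambda>m'. encodes n (absorb (parcs G) X u) (m' (cand k)))"
proof -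
  let ?P = "Cond (Read ''adj'' (Add (Var (row k)) (Var ''v'')))
      (Write (cand k) (Var ''v'') (Lit 0))
      (Write (cand k) (Var ''v'') (Read (cand (Suc k)) (Var ''v'')))"
  \<comment> \<open>The loop only removes the neighbours of \<open>u\<close>; the final write
    inserts \<open>u\<close> itself.\<close>
  let ?J = "\<lambda>i m'. \<forall>v<i. m' (cand k) v = of_bool (v \<in> X - parcs G `` {u})"
  have "halts (For ''v'' ?P) m (9 + 25 * n) (?J n)"
  proof (rule halts_For[where T = 13 and J = ?J and n = n])
    fix i m' assume i: "i < n" "?J i m'" "m' ''v'' 0 = i"
      "\<And>y. y \<noteq> ''v'' \<Longrightarrow> y \<notin> writes ?P \<Longrightarrow> m' y = m y"
    have "m' ''adj'' = m ''adj''" "m' (row k) = m (row k)" "m' (cand (Suc k)) = m (cand (Suc k))"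
      using i(4) by auto
    then show "halts ?P m' 13 (?J (Suc i))"
      using i(1-3) u X G
      by (intro halts_Cond[where T = 6] halts_Write)
        (auto simp: encodes_def stores_graph_def less_Suc_eq split: if_splits)
  qed (use G in \<open>auto simp: stores_graph_def\<close>)
  then have "halts (For ''v'' ?P) m (9 + 25 * n)
      (\<lambda>m'. halts (Write (cand k) (Var (ctr k)) (Lit 1)) m' 4
        (\<lambda>m'. encodes n (absorb (parcs G) X u) (m' (cand k))))"
    using u by (elim halts_conseq) (auto simp: encodes_def absorb_def intro!: halts_Write)
  then show ?thesis unfolding absorb_com_def by (rule halts_Seq) simp
qed

section \<open>Exhaustive search over all moves\<close>

definition candidates :: "nat \<Rightarrow> nat set \<Rightarrow> nat set set" where
  "candidates k X = foldl (absorb (parcs G)) X ` {us. length us = k \<and> set us \<subseteq> {..<n}}"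

lemma candidates_0 [simp]: "candidates 0 X = {X}"
  by (auto simp: candidates_def)

text \<open>The first vertex of the list corresponds to the outermost loop of
  \<open>search_com\<close>.\<close>

lemma candidates_Suc: "candidates (Suc k) X = (\<Union>u<n. candidates k (absorb (parcs G) X u))"
proof -
  have "{us. length us = Suc k \<and> set us \<subseteq> {..<n}} =
      (\<Union>u<n. Cons u ` {us. length us = k \<and> set us \<subseteq> {..<n}})"
    by (auto simp: length_Suc_conv)
  then show ?thesis by (simp add: candidates_def image_UN image_image)
qed

lemma independent_set_candidates:
  assumes "independent_set G X" "Y \<in> candidates k X"
  shows "independent_set G Y"
  using assms
  by (induction k arbitrary: X) (auto simp: candidates_Suc pverts dest: independent_set_absorb)

text \<open>Relates the best set before and after a scan of \<open>\<C>\<close>. Strictness in the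
  second case ensures that every replacement is progress.\<close>

definition improves :: "nat set set \<Rightarrow> nat set \<Rightarrow> nat set \<Rightarrow> bool" where
  "improves \<C> Y Y' \<longleftrightarrow> (Y' = Y \<or> Y' \<in> \<C> \<and> card Y < card Y') \<and> (\<forall>Z\<in>\<C>. card Z \<le> card Y')"

lemma improves_Un: "improves \<C> X Y \<Longrightarrow> improves \<D> Y Z \<Longrightarrow> improves (\<C> \<union> \<D>) X Z"
  unfolding improves_def by (auto dest: le_less_trans less_imp_le)

definition improved_output :: "nat set set \<Rightarrow> nat set \<Rightarrow> memory \<Rightarrow> bool" where
  "improved_output \<C> Y m \<longleftrightarrow>
    (\<exists>Y'. encodes n Y' (m ''out'') \<and> independent_set G Y' \<and> improves \<C> Y Y')"

text \<open>The induction leaves \<open>Y\<close> arbitrary, because each round of the loop starts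
  from the output of the previous one.\<close>

lemma halts_search_com:
  assumes "stores_graph m" "encodes n X (m (cand k))" "independent_set G X"
    and "encodes n Y (m ''out'')" "independent_set G Y"
  shows "halts (search_com k) m (search_time n k) (improved_output (candidates k X) Y)"
  using assms
proof (induction k arbitrary: m X Y)
  case 0
  let ?copy = "Cond (Sub (Var ''d'') (Var ''e'')) (copy_com ''out'' (cand 0)) Skip"
  have n: "m ''n'' 0 = n" using 0 by (simp add: stores_graph_def)
  have copy: "halts ?copy m' (15 + 18 * n) (improved_output {X} Y)"
    if m': "m' ''d'' 0 = card X" "m' ''e'' 0 = card Y" "\<And>x. x \<notin> writes sizes_com \<Longrightarrow> m' x = m x"
    for m'
  proof (rule halts_Cond[where T = "9 + 18 * n"])
    assume "aval (Sub (Var ''d'') (Var ''e'')) m' \<noteq> 0"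
    then have less: "card Y < card X" using m' by simp
    have "m' ''n'' 0 = n" "m' (cand 0) = m (cand 0)" using n m' by auto
    then show "halts (copy_com ''out'' (cand 0)) m' (9 + 18 * n) (improved_output {X} Y)"
      using 0 less by (intro halts_conseq[OF halts_copy_com[of _ n]])
        (auto simp: improved_output_def improves_def encodes_def intro!: exI[of _ X])
  next
    assume "aval (Sub (Var ''d'') (Var ''e'')) m' = 0"
    then have "card X \<le> card Y" using m' by simp
    moreover have "m' ''out'' = m ''out''" using m' by simp
    ultimately show "halts Skip m' (9 + 18 * n) (improved_output {X} Y)"
      using 0 by (intro halts_Skip) (auto simp: improved_output_def improves_def)
  qed simp
  have "halts sizes_com m (15 + 28 * n) (\<lambda>m'. halts ?copy m' (15 + 18 * n) (improved_output {X} Y))"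
    using 0 n independent_set_less
    by (intro halts_conseq[OF halts_sizes_com[of _ n X Y]] copy) auto
  then show ?case by (auto intro!: halts_Seq)
next
  case (Suc k)
  let ?next = "Write (row k) (Lit 0) (Add (Var (row k)) (Var ''n''))"
  let ?P = "Seq (absorb_com k) (Seq (search_com k) ?next)"
  let ?X = "\<lambda>u. absorb (parcs G) X u"
  \<comment> \<open>After \<open>i\<close> rounds the output is at least as large as every candidate
    whose first absorbed vertex is below \<open>i\<close>.\<close>
  let ?J = "\<lambda>i m'. m' (row k) 0 = i * n \<and> improved_output (\<Union>u<i. candidates k (?X u)) Y m'"
  let ?m = "m(row k := (m (row k))(0 := 0))"
  let ?T = "20 + 25 * n + search_time n k"
  have n: "m ''n'' 0 = n" using Suc.prems by (simp add: stores_graph_def)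
  have "halts (For (ctr k) ?P) ?m (9 + n * (?T + 12)) (?J n)"
  proof (rule halts_For[where T = ?T and J = ?J and n = n])
    fix i m' assume i: "i < n" "?J i m'" "m' (ctr k) 0 = i"
      "\<And>y. y \<noteq> ctr k \<Longrightarrow> y \<notin> writes ?P \<Longrightarrow> m' y = ?m y"
    obtain Y1 where Y1: "encodes n Y1 (m' ''out'')" "independent_set G Y1"
      "improves (\<Union>u<i. candidates k (?X u)) Y Y1"
      using i(2) unfolding improved_output_def by blast
    have m': "m' ''n'' = m ''n''" "m' ''adj'' = m ''adj''" "m' (cand (Suc k)) = m (cand (Suc k))"
      using i(4)[of "''n''"] i(4)[of "''adj''"] i(4)[of "cand (Suc k)"]
      by (auto simp: writes_search_com)
    have G': "stores_graph m'" using stores_graph_cong[OF Suc.prems(1)] m' by blast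
    have next_ok: "halts ?next m2 7 (?J (Suc i))"
      if "improved_output (candidates k (?X i)) Y1 m2" "m2 (row k) = m' (row k)" "m2 ''n'' = m' ''n''"
      for m2
    proof (rule halts_Write)
      have "improved_output (\<Union>u<Suc i. candidates k (?X u)) Y m2"
        using that(1) improves_Un[OF Y1(3)]
        by (auto simp: improved_output_def lessThan_Suc Un_commute)
      then show "?J (Suc i) (m2(row k := (m2 (row k))
          (aval (Lit 0) m2 := aval (Add (Var (row k)) (Var ''n'')) m2)))"
        using that i(2) m' n by (auto simp: improved_output_def)
    qed simp
    have search: "halts (Seq (search_com k) ?next) m1 (search_time n k + 7) (?J (Suc i))"
      if m1: "encodes n (?X i) (m1 (cand k))" "\<And>x. x \<notin> writes (absorb_com k) \<Longrightarrow> m1 x = m' x" for m1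
    proof (rule halts_Seq[OF halts_conseq[OF Suc.IH[of m1 "?X i" Y1]]])
      show "stores_graph m1" using stores_graph_cong[OF G'] m1 by simp
      show "independent_set G (?X i)"
        using independent_set_absorb Suc.prems i pverts by simp
      show "encodes n Y1 (m1 ''out'')" using Y1 m1 by simp
      show "independent_set G Y1" by (rule Y1)
      show "halts ?next m2 7 (?J (Suc i))"
        if "improved_output (candidates k (?X i)) Y1 m2" "\<And>x. x \<notin> writes (search_com k) \<Longrightarrow> m2 x = m1 x" for m2
        using that m1 by (intro next_ok) (auto simp: writes_search_com)
    qed (use m1 in auto)
    have "halts (absorb_com k) m' (13 + 25 * n)
        (\<lambda>m1. halts (Seq (search_com k) ?next) m1 (search_time n k + 7) (?J (Suc i)))"
      using G' i Suc.prems m' by (intro halts_conseq[OF halts_absorb_com[of _ i k X]] search) auto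
    then show "halts ?P m' ?T (?J (Suc i))" by (rule halts_Seq) simp
  qed (use n Suc.prems in \<open>auto simp: writes_search_com improved_output_def improves_def\<close>)
  then have "halts (For (ctr k) ?P) ?m (9 + n * (?T + 12)) (improved_output (candidates (Suc k) X) Y)"
    by (rule halts_conseq) (auto simp: candidates_Suc)
  then show ?case by (auto intro!: halts_Seq[where T = 3] halts_Write simp: algebra_simps)
qed

section \<open>Repeated passes reach a local optimum\<close>

definition locally_optimal :: "nat \<Rightarrow> nat set \<Rightarrow> bool" where
  "locally_optimal k Y \<longleftrightarrow> (\<forall>Z\<in>candidates k Y. card Z \<le> card Y)"

text \<open>
  Each pass either enlarges the output or leaves a local optimum, so \<open>n\<close> passes suffice: a set of
  \<open>n\<close> vertices is trivially optimal.
\<close>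

lemma halts_local_search_com:
  "halts (local_search_com a) (graph_input n G) (local_search_time n a)
    (\<lambda>m. \<exists>Y. encodes n Y (m ''out'') \<and> independent_set G Y \<and> locally_optimal a Y)"
proof -
  let ?m = "graph_input n G"
  let ?P = "Seq (copy_com (cand a) ''out'') (search_com a)"
  let ?J = "\<lambda>i m. \<exists>Y. encodes n Y (m ''out'') \<and> independent_set G Y \<and>
    (i \<le> card Y \<or> locally_optimal a Y)"
  let ?T = "9 + 18 * n + search_time n a"
  have "halts (local_search_com a) ?m (local_search_time n a) (?J n)"
    unfolding local_search_com_def
  proof (rule halts_For[where T = ?T and J = ?J and n = n])
    show "?J 0 ?m"
      by (intro exI[of _ "{}"]) (auto simp: encodes_def graph_input_def independent_set_def)
    fix i m' assume i: "?J i m'" "\<And>y. y \<noteq> ''p'' \<Longrightarrow> y \<notin> writes ?P \<Longrightarrow> m' y = ?m y"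
    obtain Y where Y: "encodes n Y (m' ''out'')" "independent_set G Y"
      "i \<le> card Y \<or> locally_optimal a Y"
      using i by blast
    have "m' ''n'' = ?m ''n''" "m' ''adj'' = ?m ''adj''"
      using i(2)[of "''n''"] i(2)[of "''adj''"] by (auto simp: writes_search_com)
    then have G': "stores_graph m'" using stores_graph_cong[OF stores_graph_input] by blast
    \<comment> \<open>If the pass keeps \<open>Y\<close>, no candidate beats it. If it replaces
      \<open>Y\<close>, then \<open>Y\<close> was not locally optimal, so
      \<open>i \<le> card Y\<close>, and the size grows.\<close>
    have result: "?J (Suc i) m2" if "improved_output (candidates a Y) Y m2" for m2
      using that Y(3) unfolding improved_output_def improves_def locally_optimal_def
      by (meson Suc_leI le_less_trans not_le)
    have "halts (search_com a) m1 (search_time n a) (?J (Suc i))"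
      if "\<forall>v<n. m1 (cand a) v = m' ''out'' v" "\<And>x. x \<notin> {''v'', cand a} \<Longrightarrow> m1 x = m' x" for m1
      using that Y stores_graph_cong[OF G', of m1]
      by (intro halts_conseq[OF halts_search_com[of m1 Y a Y]] result) (auto simp: encodes_def)
    then show "halts ?P m' ?T (?J (Suc i))"
      using G' by (intro halts_Seq[OF halts_conseq[OF halts_copy_com[of _ n]]])
        (auto simp: stores_graph_def)
  qed (use stores_graph_input in
      \<open>auto simp: stores_graph_def writes_search_com local_search_time_def algebra_simps\<close>)
  then show ?thesis
  proof (rule halts_conseq)
    fix m' assume "?J n m'"
    then obtain Y where Y: "encodes n Y (m' ''out'')" "independent_set G Y"
      "n \<le> card Y \<or> locally_optimal a Y" by blast
    \<comment> \<open>Candidates are independent sets among \<open>n\<close> vertices, so none beats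
      a set of size \<open>n\<close>.\<close>
    have "card Z \<le> n" if "Z \<in> candidates a Y" for Z
      using independent_set_less[OF independent_set_candidates[OF Y(2) that]]
        card_mono[of "{..<n}"] by simp
    then have "locally_optimal a Y" using Y(3) by (fastforce simp: locally_optimal_def)
    then show "\<exists>Y. encodes n Y (m' ''out'') \<and> independent_set G Y \<and> locally_optimal a Y"
      using Y by blast
  qed simp
qed

end

theorem theorem3:
  shows "\<exists>(C::real) (c::nat). C > 0 \<and>
    (\<forall>(a::nat) (b::nat). 1 \<le> a \<longrightarrow> 1 \<le> b \<longrightarrow>
      (\<exists>P::com. \<forall>(n::nat) (G::nat pair_pre_digraph).
        pair_graph G \<longrightarrow> pverts G = {..<n} \<longrightarrow> biclique_free a b (with_proj G) \<longrightarrow>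
        (\<exists>(t::nat) (m::memory).
          runs P (graph_input n G) t m \<and>
          t \<le> (max 2 n) ^ (c * a) \<and>
          independent_set (with_proj G) (output_set n m) \<and>
          real (card (output_set n m)) *
            (C * real (a + b) powr (1 / real a) *
              real (independence_number (with_proj G)) powr (1 - 1 / real a))
            \<ge> real (independence_number (with_proj G)))))"
proof (intro exI[of _ "1::real"] exI[of _ "26::nat"] conjI allI impI)
  fix a b :: nat assume a: "1 \<le> a" and "1 \<le> b"
  \<comment> \<open>\<open>C = 1\<close> because the counting bound contributes only the factor
    \<open>a + b\<close> under the root; 26 is the exponent of
    \<open>local_search_time_le\<close>.\<close>
  have "\<exists>t m. runs (local_search_com a) (graph_input n G) t m \<and> t \<le> max 2 n ^ (26 * a) \<and>
      independent_set (with_proj G) (output_set n m) \<and>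
      real (independence_number (with_proj G)) \<le> real (card (output_set n m)) *
        (1 * real (a + b) powr (1 / real a) *
          real (independence_number (with_proj G)) powr (1 - 1 / real a))"
    if G: "pair_graph G" "pverts G = {..<n}" and bf: "biclique_free a b (with_proj G)"
    for n and G :: "nat pair_pre_digraph"
  proof -
    interpret numbered_graph G n
      using G by (simp add: numbered_graph_def numbered_graph_axioms_def)
    obtain t m Y where run: "runs (local_search_com a) (graph_input n G) t m"
      "t \<le> local_search_time n a"
      and Y: "encodes n Y (m ''out'')" "independent_set G Y" "locally_optimal a Y"
      using halts_local_search_com[of a] unfolding halts_def by blast
    have out: "output_set n m = Y"
      using Y(1) independent_set_less[OF Y(2)] by (auto simp: output_set_def encodes_def)
    have "{I. independent_set G I} \<subseteq> Pow {..<n}" using independent_set_less by blast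
    then have "finite {I. independent_set G I}" by (rule finite_subset) simp
    \<comment> \<open>Together with finiteness this makes the maximum attained, so an optimal
      \<open>J\<close> exists to compare with.\<close>
    moreover have "{} \<in> {I. independent_set G I}" by (simp add: independent_set_def)
    ultimately have "independence_number G \<in> card ` {I. independent_set G I}"
      unfolding independence_number_def by (intro Max_in) blast+
    then obtain J where J: "independent_set G J" "card J = independence_number G" by auto
    have "independence_number G \<le> (a + b) * card Y ^ a"
      using card_independent_set_le_local_optimum[OF bf a Y(2) J(1)] Y(3) J(2)
      by (auto simp: locally_optimal_def candidates_def pverts)
    from powr_approximation[OF a this] show ?thesis
      using run out Y(2) order_trans[OF run(2) local_search_time_le[OF a]] by auto
  qed
  then show "\<exists>P. \<forall>n (G :: nat pair_pre_digraph). pair_graph G \<longrightarrow> pverts G = {..<n} \<longrightarrow>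
      biclique_free a b (with_proj G) \<longrightarrow>
      (\<exists>t m. runs P (graph_input n G) t m \<and> t \<le> max 2 n ^ (26 * a) \<and>
        independent_set (with_proj G) (output_set n m) \<and>
        real (independence_number (with_proj G)) \<le> real (card (output_set n m)) *
          (1 * real (a + b) powr (1 / real a) *
            real (independence_number (with_proj G)) powr (1 - 1 / real a)))"
    by blast
qed simp

end
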